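(* Let $S$ be a recurrent laminary set on the finite alphabet $A$ relative to the involution $\theta$, whose factor complexity $p_n=\mathrm{Card}(S\cap A^n)$ satisfies $p_n=n(\mathrm{Card}(A)-2)+2$ for all $n\ge1$. If, for all $n\ge1$, $S\cap A^n$ is a monoidal basis of the subgroup $\langle A^n\rangle$ of $G_\theta$ generated by the products of $n$ letters, then $S$ is a specular set.
   Context: Words are over a finite alphabet $A$; $\varepsilon$ is the empty word. A set $S$ of words on $A$ is factorial if it contains $A$ and all the factors of its elements. For $w\in S$ let $L(w)=\{a\in A\mid aw\in S\}$, $R(w)=\{a\in A\mid wa\in S\}$, $B(w)=\{(a,b)\in A\times A\mid awb\in S\}$. A factorial set $S$ is biextendable if $B(w)\neq\emptyset$ for all $w\in S$. The extension graph $\mathcal{E}(w)$ is the undirected graph whose vertex set is the disjoint union of $L(w)$ and $R(w)$ and whose edges are the pairs in $B(w)$. A biextendable set $S$ is a tree set of characteristic $c$ if $\mathcal{E}(w)$ is a tree for every nonempty $w\in S$ and $\mathcal{E}(\varepsilon)$ is a disjoint union of $c$ trees. Let $\theta$ be an involution on $A$ (possibly with fixed points) and let $G_\theta$ be the group generated by $A$ with relations $a\theta(a)=1$, $a\in A$ (so $a^{-1}=\theta(a)$). A word is reduced if it has no factor $a\theta(a)$ with $a\in A$; every element of $G_\theta$ is represented by a unique reduced word, and reduced words are identified with elements of $G_\theta$. A laminary set on $A$ relative to $\theta$ is a biextendable set of reduced words closed under taking inverses. A specular set is a laminary set which is a tree set of characteristic $2$. A set $S\ne\{\varepsilon\}$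 is recurrent if it is factorial and for all $u,w\in S$ there is $v\in S$ with $uvw\in S$. A set $X$ is a monoidal basis of a group $H$ if $X\subset H$ is closed under taking inverses, the monoid generated by $X$ is $H$, and any product $x_1x_2\cdots x_m$ ($m\ge1$) of elements of $X$ such that $x_kx_{k+1}\neq 1$ for $1\le k\le m-1$ is different from $1$. *)

theory Defs
  imports "HOL-Algebra.Generated_Groups" "HOL-Library.Sublist" "HOL-Library.Disjoint_Sets"
begin

section \<open>Undirected graphs\<close>

text \<open>
  A simple undirected graph is a vertex set \<open>V\<close> with a set \<open>E\<close> of two-element subsets of \<open>V\<close>.
  The digraph notion of a tree from the AFP entry Graph-Theory is not suitable here: there a cycle
  is a directed closed walk, so that going along an undirected edge and back counts as one.
\<close>

definition connected_graph :: "'v set \<Rightarrow> 'v set set \<Rightarrow> bool" where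
  "connected_graph V E \<longleftrightarrow> V \<noteq> {} \<and> (\<forall>u\<in>V. \<forall>v\<in>V. (u, v) \<in> {(x, y). {x, y} \<in> E}\<^sup>*)"

definition graph_cycle :: "'v set set \<Rightarrow> 'v list \<Rightarrow> bool" where
  "graph_cycle E vs \<longleftrightarrow> length vs \<ge> 3 \<and> distinct vs \<and>
     (\<forall>i. Suc i < length vs \<longrightarrow> {vs ! i, vs ! Suc i} \<in> E) \<and> {last vs, hd vs} \<in> E"

definition tree_graph :: "'v set \<Rightarrow> 'v set set \<Rightarrow> bool" where
  "tree_graph V E \<longleftrightarrow> connected_graph V E \<and> (\<nexists>vs. graph_cycle E vs)"

definition disjoint_union_of_trees :: "nat \<Rightarrow> 'v set \<Rightarrow> 'v set set \<Rightarrow> bool" where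
  "disjoint_union_of_trees c V E \<longleftrightarrow>
     (\<exists>P. partition_on V P \<and> finite P \<and> card P = c \<and>
          (\<forall>e\<in>E. \<exists>C\<in>P. e \<subseteq> C) \<and>
          (\<forall>C\<in>P. tree_graph C {e \<in> E. e \<subseteq> C}))"

section \<open>Sets of words\<close>

definition factorial_set :: "'a set \<Rightarrow> 'a list set \<Rightarrow> bool" where
  "factorial_set A S \<longleftrightarrow> S \<subseteq> lists A \<and> (\<forall>a\<in>A. [a] \<in> S) \<and> (\<forall>w\<in>S. \<forall>u. sublist u w \<longrightarrow> u \<in> S)"

definition left_ext :: "'a set \<Rightarrow> 'a list set \<Rightarrow> 'a list \<Rightarrow> 'a set" where
  "left_ext A S w = {a \<in> A. [a] @ w \<in> S}"

definition right_ext :: "'a set \<Rightarrow> 'a list set \<Rightarrow> 'a list \<Rightarrow> 'a set" where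
  "right_ext A S w = {a \<in> A. w @ [a] \<in> S}"

definition bi_ext :: "'a set \<Rightarrow> 'a list set \<Rightarrow> 'a list \<Rightarrow> ('a \<times> 'a) set" where
  "bi_ext A S w = {(a, b) \<in> A \<times> A. [a] @ w @ [b] \<in> S}"

definition biextendable :: "'a set \<Rightarrow> 'a list set \<Rightarrow> bool" where
  "biextendable A S \<longleftrightarrow> factorial_set A S \<and> (\<forall>w\<in>S. bi_ext A S w \<noteq> {})"

definition ext_vertices :: "'a set \<Rightarrow> 'a list set \<Rightarrow> 'a list \<Rightarrow> ('a + 'a) set" where
  "ext_vertices A S w = left_ext A S w <+> right_ext A S w"

definition ext_edges :: "'a set \<Rightarrow> 'a list set \<Rightarrow> 'a list \<Rightarrow> ('a + 'a) set set" where
  "ext_edges A S w = {{Inl a, Inr b} | a b. (a, b) \<in> bi_ext A S w}"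

definition tree_set :: "'a set \<Rightarrow> nat \<Rightarrow> 'a list set \<Rightarrow> bool" where
  "tree_set A c S \<longleftrightarrow> biextendable A S \<and>
     (\<forall>w\<in>S. w \<noteq> [] \<longrightarrow> tree_graph (ext_vertices A S w) (ext_edges A S w)) \<and>
     disjoint_union_of_trees c (ext_vertices A S []) (ext_edges A S [])"

definition recurrent :: "'a set \<Rightarrow> 'a list set \<Rightarrow> bool" where
  "recurrent A S \<longleftrightarrow> S \<noteq> {[]} \<and> factorial_set A S \<and> (\<forall>u\<in>S. \<forall>w\<in>S. \<exists>v\<in>S. u @ v @ w \<in> S)"

section \<open>The group of an involution\<close>

definition involution_on :: "'a set \<Rightarrow> ('a \<Rightarrow> 'a) \<Rightarrow> bool" where
  "involution_on A \<theta> \<longleftrightarrow> (\<forall>a\<in>A. \<theta> a \<in> A \<and> \<theta> (\<theta> a) = a)"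

inductive theta_cong :: "'a set \<Rightarrow> ('a \<Rightarrow> 'a) \<Rightarrow> 'a list \<Rightarrow> 'a list \<Rightarrow> bool"
  for A \<theta> where
  refl: "w \<in> lists A \<Longrightarrow> theta_cong A \<theta> w w"
| sym: "theta_cong A \<theta> u v \<Longrightarrow> theta_cong A \<theta> v u"
| trans: "theta_cong A \<theta> u v \<Longrightarrow> theta_cong A \<theta> v w \<Longrightarrow> theta_cong A \<theta> u w"
| cancel: "u \<in> lists A \<Longrightarrow> v \<in> lists A \<Longrightarrow> a \<in> A \<Longrightarrow> theta_cong A \<theta> (u @ [a, \<theta> a] @ v) (u @ v)"

definition word_class :: "'a set \<Rightarrow> ('a \<Rightarrow> 'a) \<Rightarrow> 'a list \<Rightarrow> 'a list set" where
  "word_class A \<theta> w = {u. theta_cong A \<theta> w u}"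

text \<open>
  In the group presented by the generators \<open>A\<close> and the relations \<open>a \<theta>(a) = 1\<close>, the inverse of each
  generator is again a generator. Hence the monoid with the same presentation, which is the
  quotient of the free monoid by the congruence above, is already this group.
\<close>

definition theta_group :: "'a set \<Rightarrow> ('a \<Rightarrow> 'a) \<Rightarrow> 'a list set monoid" where
  "theta_group A \<theta> =
     \<lparr>carrier = word_class A \<theta> ` lists A,
      mult = (\<lambda>X Y. \<Union>x\<in>X. \<Union>y\<in>Y. word_class A \<theta> (x @ y)),
      one = word_class A \<theta> []\<rparr>"

definition word_inverse :: "('a \<Rightarrow> 'a) \<Rightarrow> 'a list \<Rightarrow> 'a list" where
  "word_inverse \<theta> w = rev (map \<theta> w)"

lemma theta_cong_lists:
  assumes "involution_on A \<theta>" "theta_cong A \<theta> u v"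
  shows "u \<in> lists A \<and> v \<in> lists A"
  using assms(2) by induction (use assms(1) in \<open>auto simp: involution_on_def\<close>)

lemma theta_cong_append:
  assumes "involution_on A \<theta>" "theta_cong A \<theta> u v" "p \<in> lists A" "q \<in> lists A"
  shows "theta_cong A \<theta> (p @ u @ q) (p @ v @ q)"
  using assms(2)
proof induction
  case (refl w)
  then show ?case using assms by (intro theta_cong.refl) simp
next
  case (cancel u v a)
  then show ?case
    using theta_cong.cancel[of "p @ u" A "v @ q" a \<theta>] assms by simp
qed (blast intro: theta_cong.sym theta_cong.trans)+

lemma word_class_eq_iff:
  assumes "involution_on A \<theta>" "u \<in> lists A"
  shows "word_class A \<theta> u = word_class A \<theta> v \<longleftrightarrow> theta_cong A \<theta> u v"
proof
  assume "word_class A \<theta> u = word_class A \<theta> v"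
  then show "theta_cong A \<theta> u v"
    using theta_cong.refl[OF assms(2)] theta_cong.sym unfolding word_class_def by blast
next
  assume "theta_cong A \<theta> u v"
  then show "word_class A \<theta> u = word_class A \<theta> v"
    unfolding word_class_def by (blast intro: theta_cong.sym theta_cong.trans)
qed

lemma theta_group_mult:
  assumes inv: "involution_on A \<theta>" and u: "u \<in> lists A" and v: "v \<in> lists A"
  shows "word_class A \<theta> u \<otimes>\<^bsub>theta_group A \<theta>\<^esub> word_class A \<theta> v = word_class A \<theta> (u @ v)"
proof -
  have uv: "u @ v \<in> lists A" using u v by simp
  have eq: "word_class A \<theta> (x @ y) = word_class A \<theta> (u @ v)"
    if x: "x \<in> word_class A \<theta> u" and y: "y \<in> word_class A \<theta> v" for x y
  proof -
    have c: "theta_cong A \<theta> u x" "theta_cong A \<theta> v y" using x y by (auto simp: word_class_def)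
    have l: "x \<in> lists A" using theta_cong_lists[OF inv c(1)] by (rule conjunct2)
    have "theta_cong A \<theta> (u @ v) (x @ v)"
      using theta_cong_append[OF inv c(1), of "[]" v] v by simp
    moreover have "theta_cong A \<theta> (x @ v) (x @ y)"
      using theta_cong_append[OF inv c(2), of x "[]"] l by simp
    ultimately have "theta_cong A \<theta> (u @ v) (x @ y)" by (rule theta_cong.trans)
    then show ?thesis by (rule iffD2[OF word_class_eq_iff[OF inv uv], symmetric])
  qed
  have "u \<in> word_class A \<theta> u" "v \<in> word_class A \<theta> v"
    using u v by (simp_all add: word_class_def theta_cong.refl del: in_lists_conv_set)
  then have ne: "word_class A \<theta> u \<noteq> {}" "word_class A \<theta> v \<noteq> {}" by blast+
  have "(\<Union>x\<in>word_class A \<theta> u. \<Union>y\<in>word_class A \<theta> v. word_class A \<theta> (x @ y))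
      = (\<Union>x\<in>word_class A \<theta> u. \<Union>y\<in>word_class A \<theta> v. word_class A \<theta> (u @ v))"
    by (intro SUP_cong HOL.refl eq)
  then show ?thesis using ne by (simp add: theta_group_def)
qed

lemma word_inverse_lists:
  "involution_on A \<theta> \<Longrightarrow> w \<in> lists A \<Longrightarrow> word_inverse \<theta> w \<in> lists A"
  by (auto simp: word_inverse_def involution_on_def)

lemma theta_cong_inverse_left:
  assumes inv: "involution_on A \<theta>" and "w \<in> lists A"
  shows "theta_cong A \<theta> (word_inverse \<theta> w @ w) []"
  using assms(2)
proof (induction w)
  case Nil
  then show ?case by (auto simp: word_inverse_def intro: theta_cong.refl)
next
  case (Cons a w)
  have a: "\<theta> a \<in> A" "\<theta> (\<theta> a) = a" using inv Cons.hyps by (auto simp: involution_on_def)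
  have "theta_cong A \<theta> (word_inverse \<theta> w @ [\<theta> a, \<theta> (\<theta> a)] @ w) (word_inverse \<theta> w @ w)"
    using word_inverse_lists[OF inv] Cons.hyps a(1) by (blast intro: theta_cong.cancel)
  then show ?case
    using Cons.IH a(2) by (auto simp: word_inverse_def intro: theta_cong.trans)
qed

lemma theta_group_group:
  assumes inv: "involution_on A \<theta>"
  shows "group (theta_group A \<theta>)"
proof (rule groupI)
  have car: "\<exists>w. w \<in> lists A \<and> x = word_class A \<theta> w" if "x \<in> carrier (theta_group A \<theta>)" for x
    using that unfolding theta_group_def by auto
  have incar: "word_class A \<theta> w \<in> carrier (theta_group A \<theta>)" if "w \<in> lists A" for w
    using that unfolding theta_group_def by simp
  have one: "\<one>\<^bsub>theta_group A \<theta>\<^esub> = word_class A \<theta> []" by (simp add: theta_group_def)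
  note mult = theta_group_mult[OF inv]
  show "\<one>\<^bsub>theta_group A \<theta>\<^esub> \<in> carrier (theta_group A \<theta>)"
    unfolding one by (rule incar) simp
  fix x assume "x \<in> carrier (theta_group A \<theta>)"
  then obtain u where u: "u \<in> lists A" and x: "x = word_class A \<theta> u" using car by blast
  show "\<one>\<^bsub>theta_group A \<theta>\<^esub> \<otimes>\<^bsub>theta_group A \<theta>\<^esub> x = x"
    using mult[of "[]" u] u unfolding one x by simp
  have i: "word_inverse \<theta> u \<in> lists A" using word_inverse_lists[OF inv u] .
  then have iu: "word_inverse \<theta> u @ u \<in> lists A" using u by simp
  have "word_class A \<theta> (word_inverse \<theta> u) \<otimes>\<^bsub>theta_group A \<theta>\<^esub> x = \<one>\<^bsub>theta_group A \<theta>\<^esub>"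
    unfolding x one mult[OF i u] word_class_eq_iff[OF inv iu]
    by (rule theta_cong_inverse_left[OF inv u])
  then show "\<exists>y\<in>carrier (theta_group A \<theta>). y \<otimes>\<^bsub>theta_group A \<theta>\<^esub> x = \<one>\<^bsub>theta_group A \<theta>\<^esub>"
    using incar[OF i] by (rule bexI)
  fix y assume "y \<in> carrier (theta_group A \<theta>)"
  then obtain v where v: "v \<in> lists A" and y: "y = word_class A \<theta> v" using car by blast
  have uv: "u @ v \<in> lists A" using u v by simp
  show "x \<otimes>\<^bsub>theta_group A \<theta>\<^esub> y \<in> carrier (theta_group A \<theta>)"
    unfolding x y mult[OF u v] by (rule incar[OF uv])
  fix z assume "z \<in> carrier (theta_group A \<theta>)"
  then obtain w where w: "w \<in> lists A" and z: "z = word_class A \<theta> w" using car by blast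
  have vw: "v @ w \<in> lists A" using v w by simp
  show "x \<otimes>\<^bsub>theta_group A \<theta>\<^esub> y \<otimes>\<^bsub>theta_group A \<theta>\<^esub> z
      = x \<otimes>\<^bsub>theta_group A \<theta>\<^esub> (y \<otimes>\<^bsub>theta_group A \<theta>\<^esub> z)"
    unfolding x y z mult[OF u v] mult[OF v w] mult[OF uv w] mult[OF u vw] by simp
qed

lemma theta_group_inv:
  assumes inv: "involution_on A \<theta>" and w: "w \<in> lists A"
  shows "inv\<^bsub>theta_group A \<theta>\<^esub> (word_class A \<theta> w) = word_class A \<theta> (word_inverse \<theta> w)"
proof (rule group.inv_equality[OF theta_group_group[OF inv]])
  have i: "word_inverse \<theta> w \<in> lists A" using word_inverse_lists[OF inv w] .
  show "word_class A \<theta> (word_inverse \<theta> w) \<otimes>\<^bsub>theta_group A \<theta>\<^esub> word_class A \<theta> w = \<one>\<^bsub>theta_group A \<theta>\<^esub>"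
    using theta_cong_inverse_left[OF inv w] word_class_eq_iff[OF inv, of "word_inverse \<theta> w @ w"]
      i w theta_group_mult[OF inv i w] by (simp add: theta_group_def)
  show "word_class A \<theta> w \<in> carrier (theta_group A \<theta>)"
    "word_class A \<theta> (word_inverse \<theta> w) \<in> carrier (theta_group A \<theta>)"
    using i w by (auto simp: theta_group_def)
qed

section \<open>Laminary and specular sets\<close>

definition reduced_word :: "'a set \<Rightarrow> ('a \<Rightarrow> 'a) \<Rightarrow> 'a list \<Rightarrow> bool" where
  "reduced_word A \<theta> w \<longleftrightarrow> w \<in> lists A \<and> (\<forall>a\<in>A. \<not> sublist [a, \<theta> a] w)"

definition laminary :: "'a set \<Rightarrow> ('a \<Rightarrow> 'a) \<Rightarrow> 'a list set \<Rightarrow> bool" where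
  "laminary A \<theta> S \<longleftrightarrow> biextendable A S \<and> (\<forall>w\<in>S. reduced_word A \<theta> w) \<and>
     (\<forall>w\<in>S. word_inverse \<theta> w \<in> S)"

definition specular :: "'a set \<Rightarrow> ('a \<Rightarrow> 'a) \<Rightarrow> 'a list set \<Rightarrow> bool" where
  "specular A \<theta> S \<longleftrightarrow> laminary A \<theta> S \<and> tree_set A 2 S"

section \<open>Monoidal bases\<close>

definition list_product :: "('g, 'm) monoid_scheme \<Rightarrow> 'g list \<Rightarrow> 'g" where
  "list_product G xs = foldr (\<otimes>\<^bsub>G\<^esub>) xs \<one>\<^bsub>G\<^esub>"

definition monoidal_basis :: "('g, 'm) monoid_scheme \<Rightarrow> 'g set \<Rightarrow> 'g set \<Rightarrow> bool" where
  "monoidal_basis G H X \<longleftrightarrow> X \<subseteq> H \<and> (\<forall>x\<in>X. inv\<^bsub>G\<^esub> x \<in> X) \<and>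
     {list_product G xs | xs. set xs \<subseteq> X} = H \<and>
     (\<forall>xs. set xs \<subseteq> X \<and> xs \<noteq> [] \<and>
        (\<forall>k. Suc k < length xs \<longrightarrow> xs ! k \<otimes>\<^bsub>G\<^esub> xs ! Suc k \<noteq> \<one>\<^bsub>G\<^esub>)
        \<longrightarrow> list_product G xs \<noteq> \<one>\<^bsub>G\<^esub>)"

definition words_of_length :: "nat \<Rightarrow> 'a list set \<Rightarrow> 'a list set" where
  "words_of_length n S = {w \<in> S. length w = n}"

end

theory Submission
  imports Defs
begin

text \<open>
  A cycle in the extension graph of \<open>w\<close> with \<open>|w| = n\<close> yields a vanishing product of elements of
  \<open>S \<inter> A\<^sup>n\<^sup>+\<^sup>2\<close>: attach to a left vertex \<open>a\<close> the group element \<open>\<phi> a = a\<close> and to a right vertex \<open>b\<close>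
  the element \<open>\<phi> b = (w b)\<^sup>-\<^sup>1\<close>. An edge traversed from \<open>x\<close> to \<open>y\<close> gives \<open>\<phi> x (\<phi> y)\<^sup>-\<^sup>1\<close>, which is
  \<open>a w b\<close> or its inverse, and the product along the cycle telescopes to \<open>1\<close>. Hence every extension
  graph is a forest, with \<open>|L(w)| + |R(w)| - |B(w)|\<close> trees. Summed over \<open>w \<in> S \<inter> A\<^sup>n\<close> this is
  \<open>2 p\<^sub>n\<^sub>+\<^sub>1 - p\<^sub>n\<^sub>+\<^sub>2\<close>, which equals \<open>p\<^sub>n\<close> for \<open>n \<ge> 1\<close> and \<open>2\<close> for \<open>n = 0\<close>; as each forest has at
  least one tree, it has exactly one for nonempty \<open>w\<close>.
\<close>

section \<open>Forests\<close>

text \<open>The walk is kept simple while it grows: when the next vertex has already been visited,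
  the walk is cut back to that visit instead of being extended.\<close>

lemma distinct_walk_of_rtrancl:
  assumes "(u, v) \<in> {(x, y). {x, y} \<in> E}\<^sup>*"
  obtains vs where "vs \<noteq> []" "distinct vs" "hd vs = u" "last vs = v"
    "\<And>i. Suc i < length vs \<Longrightarrow> {vs ! i, vs ! Suc i} \<in> E"
proof -
  have "\<exists>vs. vs \<noteq> [] \<and> distinct vs \<and> hd vs = u \<and> last vs = v \<and>
    (\<forall>i. Suc i < length vs \<longrightarrow> {vs ! i, vs ! Suc i} \<in> E)"
    using assms
  proof (induction rule: rtrancl_induct)
    case base
    show ?case by (rule exI[of _ "[u]"]) simp
  next
    case (step y z)
    then obtain vs where vs: "vs \<noteq> []" "distinct vs" "hd vs = u" "last vs = y"
      "\<And>i. Suc i < length vs \<Longrightarrow> {vs ! i, vs ! Suc i} \<in> E" by blast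
    have yz: "{y, z} \<in> E" using step.hyps by simp
    show ?case
    proof (cases "z \<in> set vs")
      case True
      then obtain k where k: "k < length vs" "vs ! k = z" by (auto simp: in_set_conv_nth)
      have "hd (take (Suc k) vs) = u" "last (take (Suc k) vs) = z"
        using vs k by (auto simp: take_Suc_conv_app_nth hd_append hd_conv_nth)
      then show ?thesis
        using vs k by (intro exI[of _ "take (Suc k) vs"]) auto
    next
      case False
      have "{(vs @ [z]) ! i, (vs @ [z]) ! Suc i} \<in> E" if i: "Suc i < length (vs @ [z])" for i
      proof (cases "Suc i < length vs")
        case True
        then show ?thesis using vs(5) by (simp add: nth_append)
      next
        case False
        then have "i = length vs - 1" "Suc i = length vs" using i by auto
        then show ?thesis using vs(1,4) yz by (simp add: nth_append last_conv_nth)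
      qed
      then show ?thesis using vs False by (intro exI[of _ "vs @ [z]"]) auto
    qed
  qed
  then show ?thesis using that by blast
qed

text \<open>A simple walk from \<open>u\<close> to \<open>v\<close> has at least three vertices:
  \<open>u \<noteq> v\<close> rules out one, and the absence of the edge \<open>{u, v}\<close> rules
  out two. The new edge therefore closes it to a cycle.\<close>

lemma graph_cycle_insert:
  assumes "(u, v) \<in> {(x, y). {x, y} \<in> E}\<^sup>*" "u \<noteq> v" "{u, v} \<notin> E"
  shows "\<exists>vs. graph_cycle (insert {u, v} E) vs"
proof -
  obtain vs where vs: "vs \<noteq> []" "distinct vs" "hd vs = u" "last vs = v"
    "\<And>i. Suc i < length vs \<Longrightarrow> {vs ! i, vs ! Suc i} \<in> E"
    using distinct_walk_of_rtrancl[OF assms(1)] by blast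
  have "length vs \<noteq> 1" using vs assms(2) by (auto simp: length_Suc_conv)
  moreover have "length vs \<noteq> 2"
    using vs(3,4) vs(5)[of 0] assms(3) by (auto simp: numeral_2_eq_2 length_Suc_conv)
  moreover have "length vs \<noteq> 0" using vs(1) by simp
  ultimately have "length vs \<ge> 3" by linarith
  then have "graph_cycle (insert {u, v} E) vs"
    using vs unfolding graph_cycle_def by (simp add: insert_commute)
  then show ?thesis ..
qed

lemma graph_cycle_mono: "graph_cycle E vs \<Longrightarrow> E \<subseteq> F \<Longrightarrow> graph_cycle F vs"
  unfolding graph_cycle_def by blast

lemma connected_graph_mono: "connected_graph C E \<Longrightarrow> E \<subseteq> F \<Longrightarrow> connected_graph C F"
  unfolding connected_graph_def
  using rtrancl_mono[of "{(x, y). {x, y} \<in> E}" "{(x, y). {x, y} \<in> F}"] by blast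

lemma connected_graph_join:
  assumes "connected_graph C E" "connected_graph D E" "u \<in> C" "v \<in> D" "{u, v} \<in> E"
  shows "connected_graph (C \<union> D) E"
proof -
  let ?R = "{(x, y). {x, y} \<in> E}\<^sup>*"
  have uv: "(u, v) \<in> ?R" "(v, u) \<in> ?R"
    using assms(5) by (auto intro!: r_into_rtrancl simp: insert_commute)
  \<comment> \<open>Any two vertices are linked by a detour through \<open>u\<close>.\<close>
  have via: "(x, u) \<in> ?R" "(u, x) \<in> ?R" if "x \<in> C \<union> D" for x
    using that assms(1-4) uv unfolding connected_graph_def by (meson UnE rtrancl_trans)+
  have "(x, y) \<in> ?R" if "x \<in> C \<union> D" "y \<in> C \<union> D" for x y
    by (rule rtrancl_trans[OF via(1)[OF that(1)] via(2)[OF that(2)]])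
  then show ?thesis using assms(3) unfolding connected_graph_def by blast
qed

text \<open>Start from singletons and add the edges one at a time. Each new edge merges two
  different classes, so the number of classes drops by exactly one per edge.\<close>

lemma forest_disjoint_union_of_trees:
  assumes "finite V" "finite E" "\<And>e. e \<in> E \<Longrightarrow> e \<subseteq> V \<and> card e = 2" "\<nexists>vs. graph_cycle E vs"
  shows "\<exists>c. disjoint_union_of_trees c V E \<and> c + card E = card V"
proof -
  have "\<exists>P. partition_on V P \<and> card P + card E = card V \<and> (\<forall>e\<in>E. \<exists>C\<in>P. e \<subseteq> C) \<and>
     (\<forall>C\<in>P. connected_graph C {e \<in> E. e \<subseteq> C})"
    using assms(2-4)
  proof (induction E rule: finite_induct)
    case empty
    have "partition_on V ((\<lambda>x. {x}) ` V)"
      by (auto simp: partition_on_def disjoint_def)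
    moreover have "card ((\<lambda>x. {x}) ` V) = card V" by (simp add: card_image)
    ultimately show ?case
      by (intro exI[of _ "(\<lambda>x. {x}) ` V"]) (auto simp: connected_graph_def)
  next
    case (insert e E)
    have ac: "\<nexists>vs. graph_cycle E vs"
      using insert.prems(2) graph_cycle_mono[of E _ "insert e E"] by blast
    have "\<exists>P. partition_on V P \<and> card P + card E = card V \<and> (\<forall>e\<in>E. \<exists>C\<in>P. e \<subseteq> C) \<and>
       (\<forall>C\<in>P. connected_graph C {e \<in> E. e \<subseteq> C})"
      by (rule insert.IH[OF insert.prems(1) ac]) simp
    then obtain P where P: "partition_on V P" "card P + card E = card V"
      "\<And>e. e \<in> E \<Longrightarrow> \<exists>C\<in>P. e \<subseteq> C" "\<And>C. C \<in> P \<Longrightarrow> connected_graph C {e \<in> E. e \<subseteq> C}"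
      by blast
    have "card e = 2" "e \<subseteq> V" using insert.prems(1) by auto
    then obtain u v where e: "e = {u, v}" "u \<noteq> v" and uv: "u \<in> V" "v \<in> V"
      by (auto simp: card_2_iff)
    obtain C where C: "C \<in> P" "u \<in> C" using P(1) uv by (auto simp: partition_on_def)
    obtain D where D: "D \<in> P" "v \<in> D" using P(1) uv by (auto simp: partition_on_def)
    \<comment> \<open>If both ends lay in one class, its connectedness would join them inside
      \<open>E\<close>, and the new edge would close a cycle.\<close>
    have CD: "C \<noteq> D"
    proof
      assume "C = D"
      then have "connected_graph C E" "v \<in> C"
        using connected_graph_mono[OF P(4)[OF C(1)], of E] D by auto
      then have "(u, v) \<in> {(x, y). {x, y} \<in> E}\<^sup>*"
        using C(2) unfolding connected_graph_def by blast
      then show False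
        using graph_cycle_insert[of u v E] insert.hyps insert.prems(2) e by auto
    qed
    have finP: "finite P" using assms(1) P(1) by (meson finite_elements)
    have dj: "X \<inter> Y = {}" if "X \<in> P" "Y \<in> P" "X \<noteq> Y" for X Y
      using P(1) that unfolding partition_on_def disjoint_def by blast
    let ?Q = "insert (C \<union> D) (P - {C, D})"
    \<comment> \<open>The merged class is new, so removing two classes and inserting this one
      changes the count by exactly one.\<close>
    have new: "C \<union> D \<notin> P - {C, D}"
    proof
      assume "C \<union> D \<in> P - {C, D}"
      then have "(C \<union> D) \<inter> C = {}" using dj C(1) by blast
      then show False using C(2) by blast
    qed
    have "X \<inter> (C \<union> D) = {}" if "X \<in> P - {C, D}" for X
      using that dj[of X C] dj[of X D] C(1) D(1) by auto
    then have dQ: "pairwise disjnt ?Q"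
      using dj by (auto simp: pairwise_insert pairwise_def disjnt_def)
    have "\<Union> ?Q = V" using P(1) C(1) D(1) by (auto simp: partition_on_def)
    moreover have "{} \<notin> ?Q" using P(1) C(2) by (auto simp: partition_on_def)
    ultimately have "partition_on V ?Q" using dQ by (simp add: partition_on_def)
    moreover have "card ?Q + card (insert e E) = card V"
    proof -
      have "card (P - {C, D}) = card P - 2"
        using C D CD finP by (subst card_Diff_subset) auto
      moreover have "card P \<ge> 2"
        using card_mono[OF finP, of "{C, D}"] C D CD by auto
      ultimately show ?thesis using new finP P(2) insert.hyps by simp
    qed
    moreover have "\<exists>X\<in>?Q. f \<subseteq> X" if f: "f \<in> insert e E" for f
    proof (cases "f = e")
      case True
      then show ?thesis using e C D by auto
    next
      case False
      then obtain X where "X \<in> P" "f \<subseteq> X" using f P(3) by blast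
      then show ?thesis by (cases "X \<in> {C, D}") auto
    qed
    moreover have "connected_graph X {f \<in> insert e E. f \<subseteq> X}" if "X \<in> ?Q" for X
    proof (cases "X = C \<union> D")
      case True
      have "connected_graph (C \<union> D) {f \<in> insert e E. f \<subseteq> C \<union> D}"
        by (rule connected_graph_join[OF connected_graph_mono[OF P(4)[OF C(1)]]
              connected_graph_mono[OF P(4)[OF D(1)]] C(2) D(2)])
          (use e C D in auto)
      then show ?thesis using True by simp
    next
      case False
      then have "X \<in> P" using that by blast
      from P(4)[OF this] show ?thesis by (rule connected_graph_mono) auto
    qed
    ultimately show ?case by (intro exI[of _ ?Q]) blast
  qed
  then obtain P where P: "partition_on V P" "card P + card E = card V" "\<forall>e\<in>E. \<exists>C\<in>P. e \<subseteq> C"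
     "\<forall>C\<in>P. connected_graph C {e \<in> E. e \<subseteq> C}" by blast
  moreover have "finite P" using assms(1) P(1) by (meson finite_elements)
  \<comment> \<open>The induction carries only connectedness of the classes; their acyclicity is
    inherited from the whole graph.\<close>
  moreover have "\<nexists>vs. graph_cycle {e \<in> E. e \<subseteq> C} vs" for C
    using assms(4) graph_cycle_mono[of "{e \<in> E. e \<subseteq> C}" _ E] by blast
  ultimately have "disjoint_union_of_trees (card P) V E"
    unfolding disjoint_union_of_trees_def tree_graph_def by blast
  then show ?thesis using P(2) by blast
qed

lemma disjoint_union_of_trees_pos:
  assumes "disjoint_union_of_trees c V E" "V \<noteq> {}"
  shows "c \<ge> 1"
proof -
  obtain P where "partition_on V P" "finite P" "card P = c"
    using assms(1) unfolding disjoint_union_of_trees_def by blast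
  moreover from this have "P \<noteq> {}" using assms(2) by (auto simp: partition_on_def)
  ultimately show ?thesis by (auto simp: Suc_le_eq card_gt_0_iff)
qed

lemma tree_graph_of_disjoint_union:
  assumes "disjoint_union_of_trees 1 V E"
  shows "tree_graph V E"
proof -
  obtain P where P: "partition_on V P" "card P = 1" "\<forall>e\<in>E. \<exists>C\<in>P. e \<subseteq> C"
    "\<forall>C\<in>P. tree_graph C {e \<in> E. e \<subseteq> C}"
    using assms unfolding disjoint_union_of_trees_def by blast
  obtain C where "P = {C}" using P(2) by (auto simp: card_1_singleton_iff)
  moreover from this have "C = V" using P(1) by (auto simp: partition_on_def)
  moreover have "{e \<in> E. e \<subseteq> V} = E" using P(3) calculation by auto
  ultimately show ?thesis using P(4) by simp
qed

section \<open>Monoidal bases exclude cycles\<close>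

text \<open>Adjacent inverses cancel. The start \<open>i\<close> is arbitrary because the induction
  peels off the first factor.\<close>

lemma (in group) list_product_telescope:
  assumes "\<And>j. j \<le> i + n \<Longrightarrow> f j \<in> carrier G"
  shows "list_product G (map (\<lambda>j. f j \<otimes> inv f (Suc j)) [i..<i + n]) = f i \<otimes> inv f (i + n)"
  using assms
proof (induction n arbitrary: i)
  case 0
  then show ?case by (simp add: list_product_def)
next
  case (Suc n)
  have c: "f i \<in> carrier G" "f (Suc i) \<in> carrier G" "f (Suc i + n) \<in> carrier G"
    using Suc.prems by auto
  have "list_product G (map (\<lambda>j. f j \<otimes> inv f (Suc j)) [i..<i + Suc n])
      = (f i \<otimes> inv f (Suc i)) \<otimes> list_product G (map (\<lambda>j. f j \<otimes> inv f (Suc j)) [Suc i..<Suc i + n])"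
    by (subst upt_conv_Cons) (simp_all add: list_product_def)
  also have "\<dots> = (f i \<otimes> inv f (Suc i)) \<otimes> (f (Suc i) \<otimes> inv f (Suc i + n))"
    by (subst Suc.IH) (use Suc.prems in auto)
  also have "\<dots> = f i \<otimes> inv f (i + Suc n)"
    using c by (simp add: m_assoc inv_solve_left')
  finally show ?case .
qed

text \<open>The potential \<open>\<phi>\<close> is kept abstract. Two consecutive factors multiply
  to \<open>\<phi> x \<otimes> inv \<phi> z\<close>, where \<open>x\<close> and \<open>z\<close> are
  neighbours of a common vertex, so \<open>inj\<close> is what prevents them from
  cancelling.\<close>

lemma (in group) monoidal_basis_no_cycle:
  assumes basis: "monoidal_basis G H X"
    and carr: "\<And>x y. {x, y} \<in> E \<Longrightarrow> \<phi> x \<in> carrier G"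
    and edge: "\<And>x y. {x, y} \<in> E \<Longrightarrow> \<phi> x \<otimes> inv \<phi> y \<in> X"
    and inj: "\<And>x y z. {x, y} \<in> E \<Longrightarrow> {y, z} \<in> E \<Longrightarrow> x \<noteq> z \<Longrightarrow> \<phi> x \<noteq> \<phi> z"
  shows "\<not> graph_cycle E vs"
proof
  assume "graph_cycle E vs"
  then have len: "length vs \<ge> 3" and dist: "distinct vs"
    and path: "\<And>i. Suc i < length vs \<Longrightarrow> {vs ! i, vs ! Suc i} \<in> E" and close: "{last vs, hd vs} \<in> E"
    unfolding graph_cycle_def by auto
  let ?m = "length vs"
  \<comment> \<open>Cyclic indexing makes the closing edge an ordinary step and gives
    \<open>v ?m = v 0\<close>, which collapses the telescoped product.\<close>
  define v where "v i = vs ! (i mod ?m)" for i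
  have e: "{v i, v (Suc i)} \<in> E" for i
  proof (cases "Suc (i mod ?m) = ?m")
    case True
    then have "i mod ?m = ?m - 1" "Suc i mod ?m = 0" by (auto simp: mod_Suc)
    then show ?thesis using close len unfolding v_def
      by (metis hd_conv_nth last_conv_nth list.size(3) not_numeral_le_zero)
  next
    case False
    then have "Suc i mod ?m = Suc (i mod ?m)" by (simp add: mod_Suc)
    moreover have "Suc (i mod ?m) < ?m"
      using False len by (metis Suc_lessI mod_less_divisor not_numeral_le_zero gr0I)
    ultimately show ?thesis using path unfolding v_def by simp
  qed
  have c: "\<phi> (v i) \<in> carrier G" for i using carr e by blast
  let ?g = "\<lambda>i. \<phi> (v i) \<otimes> inv \<phi> (v (Suc i))"
  have ne: "?g i \<otimes> ?g (Suc i) \<noteq> \<one>" if "Suc i < ?m" for i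
  proof -
    \<comment> \<open>This is where the length of at least three enters: vertices two steps apart on
      the cycle are distinct.\<close>
    have "i mod ?m \<noteq> Suc (Suc i) mod ?m" using that len by (auto simp: mod_Suc)
    then have "v i \<noteq> v (Suc (Suc i))"
      using dist len unfolding v_def
      by (metis gr0I mod_less_divisor not_numeral_le_zero nth_eq_iff_index_eq)
    then have "\<phi> (v i) \<noteq> \<phi> (v (Suc (Suc i)))" using inj e by blast
    moreover have "?g i \<otimes> ?g (Suc i) = \<phi> (v i) \<otimes> inv \<phi> (v (Suc (Suc i)))"
      using list_product_telescope[of i 2 "\<lambda>i. \<phi> (v i)"] c
      by (simp add: list_product_def numeral_2_eq_2)
    ultimately show ?thesis using c by (metis inv_inv inv_closed inv_equality)
  qed
  let ?xs = "map ?g [0..<?m]"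
  have "list_product G ?xs \<noteq> \<one>"
  proof -
    have "set ?xs \<subseteq> X" using edge e by auto
    moreover have "?xs \<noteq> []" using len by auto
    moreover have "?xs ! k \<otimes> ?xs ! Suc k \<noteq> \<one>" if "Suc k < length ?xs" for k
      using ne[of k] that by simp
    ultimately show ?thesis using basis unfolding monoidal_basis_def by blast
  qed
  moreover have "list_product G ?xs = \<one>"
    using list_product_telescope[of 0 ?m "\<lambda>i. \<phi> (v i)"] c c[of 0] by (simp add: v_def)
  ultimately show False by contradiction
qed

text \<open>
  Letters are told apart by counting: the parity of the number of letters in \<open>{a, \<theta> a}\<close> is invariant,
  and so is the difference of the numbers of \<open>a\<close> and of \<open>\<theta> a\<close> when these are distinct.
\<close>

lemma theta_cong_count_parity:
  assumes "involution_on A \<theta>" "theta_cong A \<theta> u v" "a \<in> A"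
  shows "even (length (filter (\<lambda>x. x = a \<or> x = \<theta> a) u)) =
    even (length (filter (\<lambda>x. x = a \<or> x = \<theta> a) v))"
  using assms(2)
proof induction
  case (cancel u v b)
  \<comment> \<open>The involution preserves the set of \<open>a\<close> and
    \<open>\<theta> a\<close>, so a cancelled pair contributes 0 or 2 to the count.\<close>
  have "b = a \<or> b = \<theta> a \<longleftrightarrow> \<theta> b = a \<or> \<theta> b = \<theta> a"
    using assms(1,3) cancel unfolding involution_on_def by metis
  then show ?case by auto
qed auto

lemma theta_cong_count_diff:
  assumes "involution_on A \<theta>" "theta_cong A \<theta> u v" "a \<in> A"
  shows "int (count_list u a) - int (count_list u (\<theta> a)) =
    int (count_list v a) - int (count_list v (\<theta> a))"
  using assms(2)
proof induction
  case (cancel u v b)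
  \<comment> \<open>A cancelled pair contains as many copies of \<open>a\<close> as of
    \<open>\<theta> a\<close>.\<close>
  have "b = a \<longleftrightarrow> \<theta> b = \<theta> a" "b = \<theta> a \<longleftrightarrow> \<theta> b = a"
    using assms(1,3) cancel unfolding involution_on_def by metis+
  then show ?case by auto
qed auto

text \<open>Parity forces \<open>b\<close> to be \<open>a\<close> or \<open>\<theta> a\<close>. If
  these differ, the difference of counts is 1 for \<open>[a]\<close> and -1 for
  \<open>[\<theta> a]\<close>, which leaves only \<open>b = a\<close>.\<close>

lemma word_class_letter_inj:
  assumes "involution_on A \<theta>" "a \<in> A" "b \<in> A" "word_class A \<theta> [a] = word_class A \<theta> [b]"
  shows "a = b"
proof -
  have c: "theta_cong A \<theta> [a] [b]"
    using assms word_class_eq_iff[of A \<theta> "[a]" "[b]"] by simp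
  show ?thesis
    using theta_cong_count_parity[OF assms(1) c assms(2)] theta_cong_count_diff[OF assms(1) c assms(2)]
    by (auto split: if_splits)
qed

section \<open>Acyclicity of extension graphs\<close>

lemma ext_edges_doubleton:
  assumes "{x, y} \<in> ext_edges A S w"
  obtains a b where "(a, b) \<in> bi_ext A S w" "x = Inl a \<and> y = Inr b \<or> x = Inr b \<and> y = Inl a"
  using assms unfolding ext_edges_def by (auto simp: doubleton_eq_iff)

text \<open>The length \<open>length w + 2\<close> is that of the words \<open>a w b\<close> read
  off the edges.\<close>

lemma ext_edges_no_cycle:
  assumes inv: "involution_on A \<theta>" and w: "w \<in> lists A"
    and basis: "monoidal_basis (theta_group A \<theta>) H (word_class A \<theta> ` words_of_length (length w + 2) S)"
  shows "\<not> graph_cycle (ext_edges A S w) vs"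
proof -
  interpret G: group "theta_group A \<theta>" by (rule theta_group_group[OF inv])
  let ?G = "theta_group A \<theta>" and ?X = "word_class A \<theta> ` words_of_length (length w + 2) S"
  have cl: "word_class A \<theta> u \<in> carrier ?G" if "u \<in> lists A" for u
    using that unfolding theta_group_def by simp
  define \<phi> where "\<phi> = case_sum (\<lambda>a. word_class A \<theta> [a]) (\<lambda>b. inv\<^bsub>?G\<^esub> word_class A \<theta> (w @ [b]))"
  have wb: "w @ [b] \<in> lists A" if "b \<in> A" for b using w that by simp
  have carr: "\<phi> x \<in> carrier ?G" if xy: "{x, y} \<in> ext_edges A S w" for x y
    using xy by (rule ext_edges_doubleton) (auto simp: \<phi>_def bi_ext_def intro!: cl wb G.inv_closed
        simp del: in_lists_conv_set)
  have edge: "\<phi> x \<otimes>\<^bsub>?G\<^esub> inv\<^bsub>?G\<^esub> \<phi> y \<in> ?X" if xy: "{x, y} \<in> ext_edges A S w" for x y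
  proof -
    from xy obtain a b where ab: "(a, b) \<in> bi_ext A S w"
      and cs: "x = Inl a \<and> y = Inr b \<or> x = Inr b \<and> y = Inl a" by (rule ext_edges_doubleton)
    have a: "a \<in> A" and b: "b \<in> A" and S: "a # w @ [b] \<in> S" using ab by (auto simp: bi_ext_def)
    have c: "word_class A \<theta> [a] \<in> carrier ?G" "word_class A \<theta> (w @ [b]) \<in> carrier ?G"
      using a wb[OF b] by (auto intro!: cl)
    have m: "word_class A \<theta> [a] \<otimes>\<^bsub>?G\<^esub> word_class A \<theta> (w @ [b]) = word_class A \<theta> (a # w @ [b])"
      using theta_group_mult[OF inv, of "[a]" "w @ [b]"] a wb[OF b] by simp
    have X: "word_class A \<theta> (a # w @ [b]) \<in> ?X"
      using S by (intro imageI) (simp add: words_of_length_def)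
    \<comment> \<open>Closure of the basis under inverses covers the edges traversed from right to
      left.\<close>
    have "inv\<^bsub>?G\<^esub> word_class A \<theta> (a # w @ [b]) \<in> ?X"
      by (rule basis[unfolded monoidal_basis_def, THEN conjunct2, THEN conjunct1, THEN bspec, OF X])
    then have "inv\<^bsub>?G\<^esub> word_class A \<theta> (w @ [b]) \<otimes>\<^bsub>?G\<^esub> inv\<^bsub>?G\<^esub> word_class A \<theta> [a] \<in> ?X"
      using G.inv_mult_group[OF c] m by simp
    then show ?thesis using cs X c m by (auto simp: \<phi>_def)
  qed
  have inj: "\<phi> x \<noteq> \<phi> z"
    if xy: "{x, y} \<in> ext_edges A S w" and yz: "{y, z} \<in> ext_edges A S w" and "x \<noteq> z" for x y z
  proof
    assume eq: "\<phi> x = \<phi> z"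
    from xy obtain a b where ab: "(a, b) \<in> bi_ext A S w"
      and cs: "x = Inl a \<and> y = Inr b \<or> x = Inr b \<and> y = Inl a" by (rule ext_edges_doubleton)
    from yz obtain a' b' where ab': "(a', b') \<in> bi_ext A S w"
      and cs': "y = Inl a' \<and> z = Inr b' \<or> y = Inr b' \<and> z = Inl a'" by (rule ext_edges_doubleton)
    have A: "a \<in> A" "b \<in> A" "a' \<in> A" "b' \<in> A" using ab ab' by (auto simp: bi_ext_def)
    \<comment> \<open>The graph is bipartite, so two neighbours of \<open>y\<close> lie on the same
      side.\<close>
    consider "x = Inl a" "z = Inl a'" | "x = Inr b" "z = Inr b'" using cs cs' by auto
    then show False
    proof cases
      case 1
      then show ?thesis
        using word_class_letter_inj[OF inv A(1,3)] eq \<open>x \<noteq> z\<close> by (simp add: \<phi>_def)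
    next
      case 2
      \<comment> \<open>On the right side, removing the inverse and then the common prefix
        \<open>w\<close> reduces the comparison to single letters.\<close>
      have "word_class A \<theta> (w @ [b]) = word_class A \<theta> (w @ [b'])"
        using inj_onD[OF G.inv_inj _ cl[OF wb[OF A(2)]] cl[OF wb[OF A(4)]]] eq 2
        by (simp add: \<phi>_def)
      then have "word_class A \<theta> w \<otimes>\<^bsub>?G\<^esub> word_class A \<theta> [b] = word_class A \<theta> w \<otimes>\<^bsub>?G\<^esub> word_class A \<theta> [b']"
        using theta_group_mult[OF inv w] A by simp
      then have "word_class A \<theta> [b] = word_class A \<theta> [b']"
        using cl[OF w] cl[of "[b]"] cl[of "[b']"] A by simp
      then show ?thesis using word_class_letter_inj[OF inv A(2,4)] 2 \<open>x \<noteq> z\<close> by simp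
    qed
  qed
  show ?thesis by (rule G.monoidal_basis_no_cycle[OF basis carr edge inj])
qed

section \<open>Counting extensions\<close>

lemma finite_words_of_length:
  assumes "finite A" "factorial_set A S"
  shows "finite (words_of_length n S)"
  by (rule finite_subset[OF _ finite_lists_length_eq[OF assms(1), of n]])
    (use assms(2) in \<open>auto simp: words_of_length_def factorial_set_def lists_eq_set\<close>)

text \<open>Deleting the first letter of a word leaves a word of \<open>S\<close> by factoriality,
  so the words of length \<open>Suc n\<close> correspond to pairs of a shorter word and a left
  extension. The next two counts delete the last letter, or both end letters.\<close>

lemma sum_card_left_ext:
  assumes "finite A" "factorial_set A S"
  shows "(\<Sum>w\<in>words_of_length n S. card (left_ext A S w)) = card (words_of_length (Suc n) S)"
proof -
  have "words_of_length (Suc n) S = (\<lambda>(w, a). a # w) ` (SIGMA w:words_of_length n S. left_ext A S w)"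
    (is "?L = ?f ` ?R")
  proof (intro equalityI subsetI)
    fix x assume "x \<in> ?L"
    then obtain a w where x: "x = a # w" "x \<in> S" "length w = n"
      by (auto simp: words_of_length_def length_Suc_conv)
    moreover have "w \<in> S" "a \<in> A"
      using x assms(2) sublist_appendI[of w "[a]" "[]"] unfolding factorial_set_def by auto
    ultimately show "x \<in> ?f ` ?R"
      by (intro image_eqI[of _ _ "(w, a)"]) (auto simp: words_of_length_def left_ext_def)
  qed (auto simp: words_of_length_def left_ext_def)
  moreover have "inj_on ?f ?R" by (auto simp: inj_on_def)
  ultimately have "card ?L = card ?R" by (simp add: card_image)
  then show ?thesis
    using finite_words_of_length[OF assms] assms(1) by (simp add: left_ext_def)
qed

lemma sum_card_right_ext:
  assumes "finite A" "factorial_set A S"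
  shows "(\<Sum>w\<in>words_of_length n S. card (right_ext A S w)) = card (words_of_length (Suc n) S)"
proof -
  have "words_of_length (Suc n) S = (\<lambda>(w, a). w @ [a]) ` (SIGMA w:words_of_length n S. right_ext A S w)"
    (is "?L = ?f ` ?R")
  proof (intro equalityI subsetI)
    fix x assume "x \<in> ?L"
    then obtain a w where x: "x = w @ [a]" "x \<in> S" "length w = n"
      by (auto simp: words_of_length_def length_Suc_conv_rev)
    moreover have "w \<in> S" "a \<in> A" using x assms(2) unfolding factorial_set_def by auto
    ultimately show "x \<in> ?f ` ?R"
      by (intro image_eqI[of _ _ "(w, a)"]) (auto simp: words_of_length_def right_ext_def)
  qed (auto simp: words_of_length_def right_ext_def)
  moreover have "inj_on ?f ?R" by (auto simp: inj_on_def)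
  ultimately have "card ?L = card ?R" by (simp add: card_image)
  then show ?thesis
    using finite_words_of_length[OF assms] assms(1) by (simp add: right_ext_def)
qed

lemma finite_bi_ext: "finite A \<Longrightarrow> finite (bi_ext A S w)"
  by (rule finite_subset[of _ "A \<times> A"]) (auto simp: bi_ext_def)

lemma sum_card_bi_ext:
  assumes "finite A" "factorial_set A S"
  shows "(\<Sum>w\<in>words_of_length n S. card (bi_ext A S w)) = card (words_of_length (n + 2) S)"
proof -
  have "words_of_length (n + 2) S =
      (\<lambda>(w, a, b). a # w @ [b]) ` (SIGMA w:words_of_length n S. bi_ext A S w)"
    (is "?L = ?f ` ?R")
  proof (intro equalityI subsetI)
    fix x assume x: "x \<in> ?L"
    then obtain a y where "x = a # y" "length y = Suc n"
      by (auto simp: words_of_length_def length_Suc_conv)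
    moreover from this(2) obtain w b where "y = w @ [b]" "length w = n"
      by (auto simp: length_Suc_conv_rev)
    ultimately have x: "x = [a] @ w @ [b]" "x \<in> S" "length w = n"
      using x by (auto simp: words_of_length_def)
    moreover have "w \<in> S" "a \<in> A" "b \<in> A"
      using x assms(2) sublist_appendI[of w "[a]" "[b]"] unfolding factorial_set_def by auto
    ultimately show "x \<in> ?f ` ?R"
      by (intro image_eqI[of _ _ "(w, a, b)"]) (auto simp: words_of_length_def bi_ext_def)
  qed (auto simp: words_of_length_def bi_ext_def)
  moreover have "inj_on ?f ?R" by (auto simp: inj_on_def)
  ultimately have "card ?L = card ?R" by (simp add: card_image)
  then show ?thesis
    using finite_words_of_length[OF assms] finite_bi_ext[OF assms(1)] by simp
qed

section \<open>Vertices, edges and trees of one extension graph\<close>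

lemma card_ext_edges: "card (ext_edges A S w) = card (bi_ext A S w)"
proof -
  have "ext_edges A S w = (\<lambda>(a, b). {Inl a, Inr b}) ` bi_ext A S w"
    by (auto simp: ext_edges_def)
  \<comment> \<open>The tags \<open>Inl\<close> and \<open>Inr\<close> recover the order of the pair
    from the unordered edge.\<close>
  moreover have "inj_on (\<lambda>(a, b). {Inl a, Inr b}) (bi_ext A S w)"
    by (auto simp: inj_on_def doubleton_eq_iff)
  ultimately show ?thesis by (simp add: card_image)
qed

lemma card_ext_vertices:
  assumes "finite A"
  shows "card (ext_vertices A S w) = card (left_ext A S w) + card (right_ext A S w)"
  unfolding ext_vertices_def using assms by (intro card_Plus) (auto simp: left_ext_def right_ext_def)

lemma ext_graph_trees:
  assumes fin: "finite A" and fac: "factorial_set A S" and inv: "involution_on A \<theta>"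
    and w: "w \<in> S"
    and basis: "monoidal_basis (theta_group A \<theta>) H (word_class A \<theta> ` words_of_length (length w + 2) S)"
  obtains c where "disjoint_union_of_trees c (ext_vertices A S w) (ext_edges A S w)"
    "c + card (bi_ext A S w) = card (left_ext A S w) + card (right_ext A S w)"
proof -
  have "finite (ext_vertices A S w)"
    unfolding ext_vertices_def using fin by (auto simp: left_ext_def right_ext_def)
  moreover have "e \<subseteq> ext_vertices A S w \<and> card e = 2" if "e \<in> ext_edges A S w" for e
  proof -
    from that obtain a b where e: "e = {Inl a, Inr b}" and ab: "a \<in> A" "b \<in> A" "[a] @ w @ [b] \<in> S"
      by (auto simp: ext_edges_def bi_ext_def)
    have "[a] @ w \<in> S" "w @ [b] \<in> S"
      using fac ab(3) sublist_appendI[of "[a] @ w" "[]" "[b]"] sublist_appendI[of "w @ [b]" "[a]" "[]"]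
      unfolding factorial_set_def by auto
    then show ?thesis using e ab by (auto simp: ext_vertices_def left_ext_def right_ext_def)
  qed
  moreover have "finite (ext_edges A S w)"
  proof -
    have "ext_edges A S w = (\<lambda>(a, b). {Inl a, Inr b}) ` bi_ext A S w" by (auto simp: ext_edges_def)
    then show ?thesis using finite_bi_ext[OF fin] by simp
  qed
  moreover have "w \<in> lists A" using fac w unfolding factorial_set_def by blast
  then have "\<nexists>vs. graph_cycle (ext_edges A S w) vs" using ext_edges_no_cycle[OF inv _ basis] by blast
  ultimately have "\<exists>c. disjoint_union_of_trees c (ext_vertices A S w) (ext_edges A S w) \<and>
      c + card (ext_edges A S w) = card (ext_vertices A S w)"
    using forest_disjoint_union_of_trees by blast
  then show ?thesis using that unfolding card_ext_edges card_ext_vertices[OF fin] by blast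
qed

theorem theorem8p6:
  fixes A :: "'a set" and \<theta> :: "'a \<Rightarrow> 'a" and S :: "'a list set"
  assumes "finite A"
    and "involution_on A \<theta>"
    and "laminary A \<theta> S"
    and "recurrent A S"
    and "\<forall>n\<ge>1. int (card (words_of_length n S)) = int n * (int (card A) - 2) + 2"
    and "\<forall>n\<ge>1. monoidal_basis (theta_group A \<theta>)
           (generate (theta_group A \<theta>) (word_class A \<theta> ` words_of_length n (lists A)))
           (word_class A \<theta> ` words_of_length n S)"
  shows "specular A \<theta> S"
proof -
  let ?V = "ext_vertices A S" and ?E = "ext_edges A S"
  have bx: "biextendable A S" using assms(3) by (simp add: laminary_def)
  then have fac: "factorial_set A S" by (simp add: biextendable_def)
  note cnt = finite_words_of_length[OF assms(1) fac]
    sum_card_left_ext[OF assms(1) fac] sum_card_right_ext[OF assms(1) fac] sum_card_bi_ext[OF assms(1) fac]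
  define p where "p n = card (words_of_length n S)" for n
  have p: "int (p n) = int n * (int (card A) - 2) + 2" if "n \<ge> 1" for n
    using assms(5) that by (simp add: p_def)
  \<comment> \<open>The basis hypothesis is applied at \<open>length w + 2\<close>, which is at
    least 1 even for the empty word.\<close>
  have "\<exists>c. disjoint_union_of_trees c (?V w) (?E w) \<and>
      c + card (bi_ext A S w) = card (left_ext A S w) + card (right_ext A S w)" if "w \<in> S" for w
    using ext_graph_trees[OF assms(1) fac assms(2) that] assms(6) by (metis le_add2 one_le_numeral le_trans)
  then obtain c where c: "\<And>w. w \<in> S \<Longrightarrow> disjoint_union_of_trees (c w) (?V w) (?E w)"
    and cc: "\<And>w. w \<in> S \<Longrightarrow>
      c w + card (bi_ext A S w) = card (left_ext A S w) + card (right_ext A S w)" by metis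
  \<comment> \<open>The identity is stated additively to avoid truncated subtraction on the
    naturals.\<close>
  have sum: "(\<Sum>w\<in>words_of_length n S. c w) + p (n + 2) = 2 * p (n + 1)" for n
  proof -
    have "(\<Sum>w\<in>words_of_length n S. c w) + p (n + 2) =
        (\<Sum>w\<in>words_of_length n S. c w + card (bi_ext A S w))"
      by (simp only: p_def sum.distrib cnt)
    also have "\<dots> = (\<Sum>w\<in>words_of_length n S. card (left_ext A S w) + card (right_ext A S w))"
      by (rule sum.cong) (auto simp: words_of_length_def cc)
    also have "\<dots> = 2 * p (n + 1)" by (simp only: p_def sum.distrib cnt) simp
    finally show ?thesis .
  qed
  \<comment> \<open>Biextendability supplies a left extension, so the graph has a vertex.\<close>
  have pos: "c w \<ge> 1" if w: "w \<in> S" for w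
  proof (rule disjoint_union_of_trees_pos[OF c[OF w]])
    obtain a b where ab: "a \<in> A" "[a] @ w @ [b] \<in> S"
      using bx w unfolding biextendable_def bi_ext_def by blast
    then have "[a] @ w \<in> S"
      using fac sublist_appendI[of "[a] @ w" "[]" "[b]"] unfolding factorial_set_def by auto
    then show "?V w \<noteq> {}" using ab by (auto simp: ext_vertices_def left_ext_def)
  qed
  have one: "c w = 1" if w: "w \<in> S" "w \<noteq> []" for w
  proof (rule ccontr)
    assume "c w \<noteq> 1"
    let ?W = "words_of_length (length w) S"
    have "length w \<ge> 1" using w(2) by (cases w) auto
    \<comment> \<open>From 1 on, \<open>p\<close> is an arithmetic progression, so its second
      difference vanishes and the tree counts \<open>c u\<close> have average 1 over
      \<open>?W\<close>.\<close>
    then have "p (length w) + p (length w + 2) = 2 * p (length w + 1)"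
      using p[of "length w"] p[of "length w + 1"] p[of "length w + 2"]
      by (simp add: algebra_simps flip: of_nat_eq_iff[where 'a=int])
    then have "(\<Sum>u\<in>?W. c u) = (\<Sum>u\<in>?W. 1)" using sum[of "length w"] by (simp add: p_def)
    moreover have "(\<Sum>u\<in>?W. 1) < (\<Sum>u\<in>?W. c u)"
    proof (rule sum_strict_mono_ex1[OF cnt(1)])
      show "\<forall>u\<in>?W. 1 \<le> c u" using pos by (simp add: words_of_length_def)
      show "\<exists>u\<in>?W. 1 < c u"
        using pos[OF w(1)] \<open>c w \<noteq> 1\<close> w(1) by (intro bexI[of _ w]) (auto simp: words_of_length_def)
    qed
    ultimately show False by simp
  qed
  have nil: "[] \<in> S"
  proof -
    \<comment> \<open>For an empty alphabet the formula would make \<open>p 2\<close> equal to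
      -2.\<close>
    have "A \<noteq> {}" using p[of 2] by auto
    then show ?thesis using fac unfolding factorial_set_def by (meson all_not_in_conv sublist_Nil_left)
  qed
  then have "words_of_length 0 S = {[]}" by (auto simp: words_of_length_def)
  \<comment> \<open>Here \<open>p 1\<close> is the number of letters and \<open>p 2\<close> is twice
    that number minus 2, so \<open>2 * p 1\<close> exceeds \<open>p 2\<close> by 2, and the sum has
    the single term \<open>c []\<close>.\<close>
  then have "c [] = 2"
    using sum[of 0] p[of 1] p[of 2] by (simp add: numeral_2_eq_2)
  then have "disjoint_union_of_trees 2 (?V []) (?E [])" using c[OF nil] by simp
  moreover have "tree_graph (?V w) (?E w)" if "w \<in> S" "w \<noteq> []" for w
    using tree_graph_of_disjoint_union c[OF that(1)] one[OF that] by simp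
  ultimately have "tree_set A 2 S" using bx by (simp add: tree_set_def)
  then show ?thesis using assms(3) by (simp add: specular_def)
qed

end
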